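(* Let $A$ be a unital $C^*$-algebra and let $a,b\in A$ be normal. Then $a=b$ if and only if $\rho(a,b)=0$. In particular, two normal elements of a $C^*$-algebra are equal if and only if they are quasinilpotent equivalent, i.e. $d_\rho(a,b)=0$.
   Context: For $a,b\in A$ and $n\geq 0$ put $C_{a,b}^n\mathbf 1=\sum_{k=0}^n(-1)^k\binom{n}{k}a^{n-k}b^k$ (with $a^0=b^0=\mathbf 1$). Define $\rho(a,b)=\limsup_{n\to\infty}\|C_{a,b}^n\mathbf 1\|^{1/n}$ and $d_\rho(a,b)=\max\{\rho(a,b),\rho(b,a)\}$. *)

theory Defs
  imports "HOL-Analysis.Analysis"
begin

class cstar_algebra = banach + real_normed_algebra_1 +
  fixes scaleC :: "complex \<Rightarrow> 'a \<Rightarrow> 'a"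
    and star :: "'a \<Rightarrow> 'a"
  assumes scaleC_scaleR: "scaleC (complex_of_real r) x = scaleR r x"
    and scaleC_add_left: "scaleC (c + d) x = scaleC c x + scaleC d x"
    and scaleC_add_right: "scaleC c (x + y) = scaleC c x + scaleC c y"
    and scaleC_scaleC: "scaleC c (scaleC d x) = scaleC (c * d) x"
    and scaleC_one: "scaleC 1 x = x"
    and scaleC_mult_left: "scaleC c x * y = scaleC c (x * y)"
    and scaleC_mult_right: "x * scaleC c y = scaleC c (x * y)"
    and norm_scaleC: "norm (scaleC c x) = cmod c * norm x"
    and star_star: "star (star x) = x"
    and star_add: "star (x + y) = star x + star y"
    and star_mult: "star (x * y) = star y * star x"
    and star_scaleC: "star (scaleC c x) = scaleC (cnj c) (star x)"
    and cstar_identity: "norm (star x * x) = (norm x)\<^sup>2"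

definition normal :: "'a::cstar_algebra \<Rightarrow> bool" where
  "normal a \<longleftrightarrow> star a * a = a * star a"

definition Cn1 :: "'a::real_normed_algebra_1 \<Rightarrow> 'a \<Rightarrow> nat \<Rightarrow> 'a" where
  "Cn1 a b n = (\<Sum>k\<le>n. ((-1) ^ k * of_nat (n choose k)) * (a ^ (n - k) * b ^ k))"

definition rho :: "'a::real_normed_algebra_1 \<Rightarrow> 'a \<Rightarrow> ereal" where
  "rho a b = limsup (\<lambda>n. ereal (root n (norm (Cn1 a b n))))"

definition d_rho :: "'a::real_normed_algebra_1 \<Rightarrow> 'a \<Rightarrow> ereal" where
  "d_rho a b = max (rho a b) (rho b a)"

end

theory Submission
  imports Defs
begin

text \<open>
  Put \<open>N z = \<parallel>exp (z a) exp (- z b)\<parallel>\<close>. The product has the power series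
  \<open>\<Sum>n. z\<^sup>n C\<^sup>n 1 / n!\<close>, so \<open>\<rho>(a, b) = 0\<close> says that for every \<open>\<epsilon> > 0\<close> there is \<open>K\<close> with
  \<open>N z \<le> K exp (\<epsilon> |z|)\<close>. By normality, splitting off unitary factors turns the two
  exponentials into exponentials of the self-adjoint elements \<open>Re (z a)\<close> and \<open>- Re (z b)\<close>
  without changing \<open>N z\<close>. For self-adjoint \<open>s, t\<close> the \<open>C\<^sup>*\<close>-identity gives
  \<open>\<parallel>t s\<parallel>\<^sup>2 \<le> \<parallel>t\<^sup>2 s\<^sup>2\<parallel>\<close>, hence \<open>(N z)\<^sup>2 \<le> N (2 z)\<close>. Iterating this against the growth bound
  yields \<open>N z \<le> exp (\<epsilon> |z|)\<close>, thus \<open>N \<le> 1\<close>, and by Liouville's theorem the linear coefficient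
  \<open>a - b\<close> vanishes.
\<close>

section \<open>Complex scalars and the involution\<close>

lemma scaleC_zero_left [simp]: "scaleC 0 (x::'a::cstar_algebra) = 0"
  using scaleC_scaleR[of 0 x] by simp

lemma scaleC_minus_left: "scaleC (- c) (x::'a::cstar_algebra) = - scaleC c x"
  using scaleC_add_left[of "- c" c x] by (simp add: eq_neg_iff_add_eq_0)

lemma scaleC_sum_left:
  "scaleC (\<Sum>i\<in>A. c i) (x::'a::cstar_algebra) = (\<Sum>i\<in>A. scaleC (c i) x)"
  by (induction A rule: infinite_finite_induct) (auto simp: scaleC_add_left)

lemma scaleC_power: "scaleC c (x::'a::cstar_algebra) ^ n = scaleC (c ^ n) (x ^ n)"
  by (induction n)
    (auto simp: scaleC_one scaleC_mult_left scaleC_mult_right scaleC_scaleC mult.commute)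

lemma bounded_linear_scaleC: "bounded_linear (scaleC c :: 'a::cstar_algebra \<Rightarrow> 'a)"
proof (rule bounded_linear_intro)
  show "scaleC c (r *\<^sub>R x) = r *\<^sub>R scaleC c x" for r and x :: 'a
    by (simp add: scaleC_scaleR[symmetric] scaleC_scaleC mult.commute)
  show "norm (scaleC c x) \<le> norm x * cmod c" for x :: 'a
    by (simp add: norm_scaleC mult.commute)
qed (rule scaleC_add_right)

text \<open>The C*-identity and submultiplicativity bound any norm by that of its adjoint; applied
  to \<open>star x\<close> as well, this gives equality.\<close>

lemma norm_star [simp]: "norm (star (x::'a::cstar_algebra)) = norm x"
proof -
  have le: "norm y \<le> norm (star y)" for y :: 'a
  proof (cases "y = 0")
    case False
    have "norm y * norm y = norm (star y * y)"
      by (simp add: cstar_identity power2_eq_square)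
    also have "\<dots> \<le> norm (star y) * norm y" by (rule norm_mult_ineq)
    finally show ?thesis using False by simp
  qed simp
  show ?thesis using le[of x] le[of "star x"] by (simp add: star_star)
qed

lemma star_scaleR: "star (r *\<^sub>R (x::'a::cstar_algebra)) = r *\<^sub>R star x"
  by (simp add: scaleC_scaleR[symmetric] star_scaleC)

lemma bounded_linear_star: "bounded_linear (star :: 'a::cstar_algebra \<Rightarrow> 'a)"
  by (rule bounded_linear_intro[where K = 1]) (auto simp: star_add star_scaleR)

lemma star_minus: "star (- (x::'a::cstar_algebra)) = - star x"
  by (rule bounded_linear.linear[OF bounded_linear_star, THEN linear_neg])

lemma star_diff: "star ((x::'a::cstar_algebra) - y) = star x - star y"
  by (rule bounded_linear.linear[OF bounded_linear_star, THEN linear_diff])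

lemma star_one [simp]: "star (1::'a::cstar_algebra) = 1"
  using star_mult[of "star 1" "1::'a"] by (simp add: star_star)

lemma star_power: "star ((x::'a::cstar_algebra) ^ n) = star x ^ n"
  by (induction n) (auto simp: star_mult power_commutes)

lemma star_exp: "star (exp (x::'a::cstar_algebra)) = exp (star x)"
proof -
  have "star (\<Sum>n. x ^ n /\<^sub>R fact n) = (\<Sum>n. star (x ^ n /\<^sub>R fact n))"
    by (rule bounded_linear.suminf[OF bounded_linear_star summable_exp_generic])
  then show ?thesis by (simp add: exp_def star_scaleR star_power)
qed

section \<open>Norms of unitary and self-adjoint elements\<close>

text \<open>The exponential of a skew-adjoint element is unitary: its adjoint is
  \<open>exp (- x)\<close>, its inverse.\<close>

lemma norm_exp_skew:
  assumes "star x = - (x::'a::cstar_algebra)"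
  shows "norm (exp x) = 1"
proof -
  have "(norm (exp x))\<^sup>2 = norm (exp (- x) * exp x)"
    by (simp add: cstar_identity[symmetric] star_exp assms)
  also have "exp (- x) * exp x = 1"
    by (metis exp_minus_inverse minus_minus)
  finally show ?thesis using power2_eq_iff_nonneg[of "norm (exp x)" 1] by simp
qed

text \<open>Each squaring is one use of the C*-identity. Powers of two suffice below and stand in
  for the fact that norm and spectral radius agree on self-adjoint elements.\<close>

lemma norm_selfadjoint_power:
  assumes "star x = (x::'a::cstar_algebra)"
  shows "norm (x ^ (2 ^ m)) = norm x ^ (2 ^ m)"
proof (induction m)
  case (Suc m)
  have "norm (x ^ (2 ^ Suc m)) = norm (star (x ^ (2 ^ m)) * x ^ (2 ^ m))"
    by (simp add: star_power assms power_add[symmetric] mult_2)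
  also have "\<dots> = norm x ^ (2 ^ Suc m)"
    by (simp add: cstar_identity Suc power_mult[symmetric] mult.commute)
  finally show ?case .
qed simp

text \<open>An elementary way to take roots of order \<open>2 ^ m\<close> and let m grow: if
  \<open>W > q > 0\<close>, the powers of \<open>W / q\<close> would outgrow
  \<open>K / q\<close>.\<close>

lemma le_of_power_le_mult_power:
  fixes W q K :: real
  assumes "0 \<le> q" and le: "\<And>m. W ^ (2 ^ m) \<le> K * q ^ (2 ^ m - 1)"
  shows "W \<le> q"
proof (rule ccontr)
  assume "\<not> W \<le> q"
  show False
  proof (cases "q = 0")
    case True
    \<comment> \<open>The case m = 0 says nothing here because \<open>0 ^ 0 = 1\<close>; m = 1 gives
      \<open>W ^ 2 \<le> 0\<close>.\<close>
    then show False using le[of 1] \<open>\<not> W \<le> q\<close> by (simp add: not_le)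
  next
    case False
    then have q: "0 < q" and Wq: "1 < W / q"
      using \<open>0 \<le> q\<close> \<open>\<not> W \<le> q\<close> by auto
    obtain n where "K / q < (W / q) ^ n" using real_arch_pow[OF Wq] by blast
    also have "\<dots> \<le> (W / q) ^ (2 ^ n)"
      using Wq by (intro power_increasing) (auto intro: less_imp_le)
    also have "\<dots> = W ^ (2 ^ n) / q ^ (2 ^ n)" by (simp add: power_divide)
    also have "\<dots> \<le> K * q ^ (2 ^ n - 1) / q ^ (2 ^ n)"
      using q by (intro divide_right_mono le) auto
    also have "q ^ (2 ^ n) = q * q ^ (2 ^ n - 1)"
      using power_minus_mult[of "2 ^ n" q] by (simp add: mult.commute)
    finally show False using q by simp
  qed
qed

text \<open>With \<open>w = s t\<^sup>2 s\<close> one has \<open>\<parallel>t s\<parallel>\<^sup>2 = \<parallel>w\<parallel>\<close>, and \<open>w\<close> has the same spectral radius as \<open>t\<^sup>2 s\<^sup>2\<close>.\<close>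

lemma norm_mult_selfadjoint_square_le:
  fixes s t :: "'a::cstar_algebra"
  assumes s: "star s = s" and t: "star t = t"
  shows "(norm (t * s))\<^sup>2 \<le> norm (t\<^sup>2 * s\<^sup>2)"
proof -
  define w where "w = s * t\<^sup>2 * s"
  have "star (t * s) * (t * s) = w"
    by (simp add: star_mult s t w_def power2_eq_square mult.assoc)
  then have norm_w: "(norm (t * s))\<^sup>2 = norm w"
    using cstar_identity[of "t * s"] by simp
  have "star w = w"
    by (simp add: w_def star_mult star_power s t mult.assoc)
  \<comment> \<open>Regrouping the factors costs one power of \<open>t\<^sup>2 * s\<^sup>2\<close>,
    whence the exponent \<open>2 ^ m - 1\<close> below.\<close>
  have pow: "w ^ Suc n = s * (t\<^sup>2 * s\<^sup>2) ^ n * (t\<^sup>2 * s)" for n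
  proof (induction n)
    case (Suc n)
    have "w ^ Suc (Suc n) = w ^ Suc n * w" by (rule power_Suc2)
    also have "\<dots> = s * ((t\<^sup>2 * s\<^sup>2) ^ n * (t\<^sup>2 * s\<^sup>2)) * (t\<^sup>2 * s)"
      unfolding Suc by (simp add: w_def power2_eq_square mult.assoc)
    finally show ?case by (simp add: power_commutes)
  qed (simp add: w_def mult.assoc)
  have "norm w \<le> norm (t\<^sup>2 * s\<^sup>2)"
  proof (rule le_of_power_le_mult_power)
    fix m :: nat
    obtain n where n: "2 ^ m = Suc n" by (metis not0_implies_Suc power_not_zero zero_neq_numeral)
    have "norm w ^ (2 ^ m) = norm (w ^ Suc n)"
      using norm_selfadjoint_power[OF \<open>star w = w\<close>, of m] n by simp
    also have "\<dots> \<le> norm s * norm ((t\<^sup>2 * s\<^sup>2) ^ n) * norm (t\<^sup>2 * s)"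
      unfolding pow by (meson norm_mult_ineq order_trans mult_right_mono norm_ge_zero)
    also have "\<dots> \<le> norm s * norm (t\<^sup>2 * s\<^sup>2) ^ n * norm (t\<^sup>2 * s)"
      by (intro mult_right_mono mult_left_mono norm_power_ineq) auto
    finally show "norm w ^ (2 ^ m) \<le> (norm s * norm (t\<^sup>2 * s)) * norm (t\<^sup>2 * s\<^sup>2) ^ (2 ^ m - 1)"
      by (simp add: n mult_ac)
  qed simp
  then show ?thesis by (simp add: norm_w)
qed

section \<open>Exponentials of normal elements\<close>

lemma normal_minus: "normal a \<Longrightarrow> normal (- a)"
  by (simp add: normal_def star_minus)

lemma normal_scaleC: "normal a \<Longrightarrow> normal (scaleC c a)"
  by (simp add: normal_def star_scaleC scaleC_mult_left scaleC_mult_right scaleC_scaleC mult.commute)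

definition hermitian_part :: "'a::cstar_algebra \<Rightarrow> 'a" where
  "hermitian_part x = (x + star x) /\<^sub>R 2"

lemma star_hermitian_part [simp]: "star (hermitian_part x) = hermitian_part x"
  by (simp add: hermitian_part_def star_scaleR star_add star_star add.commute)

lemma hermitian_part_double: "hermitian_part (x + x) = hermitian_part x + hermitian_part x"
  by (simp add: hermitian_part_def star_add scaleR_add_right)

lemma exp_double: "exp (x + x) = (exp (x::'a::{real_normed_algebra_1,banach}))\<^sup>2"
  by (simp add: exp_add_commuting power2_eq_square)

text \<open>By normality the self-adjoint and skew-adjoint parts commute, so the exponential
  factors, with \<open>u\<close> the unitary exponential of the skew part and \<open>v\<close> its
  inverse. Both orders are recorded because \<open>u\<close> is later split off on the left of one
  exponential and on the right of another.\<close>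

lemma exp_normal_polar:
  assumes "normal x"
  obtains u v where "norm u = 1" "norm v = 1" "u * v = 1" "v * u = 1"
    "exp x = u * exp (hermitian_part x)" "exp x = exp (hermitian_part x) * u"
proof -
  define k where "k = (x - star x) /\<^sub>R 2"
  have k: "star k = - k"
    by (simp add: k_def star_scaleR star_diff star_star scaleR_diff_right)
  have comm: "hermitian_part x * k = k * hermitian_part x"
    using assms by (simp add: hermitian_part_def k_def normal_def algebra_simps)
  have "hermitian_part x + k = (1/2 + 1/2) *\<^sub>R x"
    unfolding hermitian_part_def k_def by (simp add: scaleR_add_right scaleR_diff_right flip: scaleR_left.add)
  then have x: "x = hermitian_part x + k" by simp
  show thesis
  proof (rule that[of "exp k" "exp (- k)"])
    show "norm (exp k) = 1" using norm_exp_skew[OF k] .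
    show "norm (exp (- k)) = 1" by (rule norm_exp_skew) (simp add: star_minus k)
    show "exp k * exp (- k) = 1" by (rule exp_minus_inverse)
    show "exp (- k) * exp k = 1" by (metis exp_minus_inverse minus_minus)
    show "exp x = exp (hermitian_part x) * exp k"
      by (metis x comm exp_add_commuting)
    show "exp x = exp k * exp (hermitian_part x)"
      by (metis x comm exp_add_commuting add.commute)
  qed
qed

lemma norm_exp_mult_exp_normal:
  assumes "normal x" and "normal y"
  shows "norm (exp x * exp y) = norm (exp (hermitian_part x) * exp (hermitian_part y))"
proof -
  let ?h = "exp (hermitian_part x) * exp (hermitian_part y)"
  obtain u u' where u: "norm u = 1" "norm u' = 1" "u' * u = 1"
    "exp x = u * exp (hermitian_part x)"
    using exp_normal_polar[OF assms(1)] by metis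
  obtain v v' where v: "norm v = 1" "norm v' = 1" "v * v' = 1"
    "exp y = exp (hermitian_part y) * v"
    using exp_normal_polar[OF assms(2)] by metis
  \<comment> \<open>Multiplying by factors of norm 1 cannot increase the norm; doing so again with
    their inverses gives the reverse inequality.\<close>
  have le: "norm (p * z * q) \<le> norm z" if "norm p = 1" "norm q = 1" for p z q :: 'a
    using norm_mult_ineq[of "p * z" q] norm_mult_ineq[of p z] that by simp
  have *: "exp x * exp y = u * ?h * v" by (simp add: u v mult.assoc)
  have "u' * (exp x * exp y) * v' = (u' * u) * ?h * (v * v')"
    unfolding * by (simp only: mult.assoc)
  then have "?h = u' * (exp x * exp y) * v'" by (simp add: u v)
  then show ?thesis using le[OF u(1) v(1), of ?h] le[OF u(2) v(2), of "exp x * exp y"] * by simp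
qed

text \<open>Doubling an exponent squares the exponential, so the inequality for self-adjoint
  \<open>s\<close> and \<open>t\<close> applies to the exponentials of the hermitian parts.\<close>

lemma norm_exp_mult_exp_normal_square_le:
  assumes "normal x" and "normal y"
  shows "(norm (exp x * exp y))\<^sup>2 \<le> norm (exp (x + x) * exp (y + y))"
proof -
  have double: "normal (z + z)" if "normal z" for z :: 'a
    using that by (simp add: normal_def star_add algebra_simps)
  have "(norm (exp (hermitian_part x) * exp (hermitian_part y)))\<^sup>2 \<le>
      norm (exp (hermitian_part (x + x)) * exp (hermitian_part (y + y)))"
    unfolding hermitian_part_double exp_double
    by (rule norm_mult_selfadjoint_square_le) (simp_all add: star_exp)
  then show ?thesis
    by (simp add: norm_exp_mult_exp_normal assms double)
qed

section \<open>Cauchy estimates for power series in the algebra\<close>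

text \<open>A full geometric sum of an m-th root of unity; distinct indices below m keep the ratio
  away from 1.\<close>

lemma sum_roots_unity_quotient:
  assumes "k < m" "n < m" "n \<noteq> k"
  defines "\<omega> \<equiv> cis (2 * pi / real m)"
  shows "(\<Sum>j<m. (\<omega> ^ n / \<omega> ^ k) ^ j) = 0"
proof -
  let ?x = "\<omega> ^ n / \<omega> ^ k"
  have pow: "\<omega> ^ i = cis (2 * pi * real i / real m)" for i
    by (simp add: \<omega>_def Complex.DeMoivre) (simp add: mult_ac)
  have "inj_on (\<lambda>i. \<omega> ^ i) {..<m}"
    unfolding pow using Complex.bij_betw_roots_unity[of m] assms by (auto simp: bij_betw_def)
  then have "\<omega> ^ n \<noteq> \<omega> ^ k" using assms by (auto dest: inj_onD)
  moreover have "\<omega> \<noteq> 0" by (simp add: \<omega>_def)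
  ultimately have "?x \<noteq> 1" by simp
  have "\<omega> ^ m = 1" using assms(1) by (simp add: pow[of m])
  then have "?x ^ m = 1"
    by (metis div_by_1 mult.commute power_divide power_mult power_one)
  then show ?thesis using \<open>?x \<noteq> 1\<close> by (simp add: geometric_sum)
qed

text \<open>Averaging over roots of unity replaces the contour integral, which the library
  offers only for complex-valued functions.\<close>

lemma power_series_Cauchy_estimate:
  fixes c :: "nat \<Rightarrow> 'a::cstar_algebra"
  assumes summable: "summable (\<lambda>n. norm (c n) * r ^ n)" and "0 \<le> r"
    and f: "\<And>z. cmod z = r \<Longrightarrow> (\<lambda>n. scaleC (z ^ n) (c n)) sums f z"
    and M: "\<And>z. cmod z = r \<Longrightarrow> norm (f z) \<le> M"
  shows "norm (c k) * r ^ k \<le> M"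
proof -
  let ?g = "\<lambda>n. norm (c n) * r ^ n"
  \<comment> \<open>Averaging over m points of the circle isolates \<open>c k\<close> up to
    coefficients of index at least m, whose contribution is bounded by the tail sum.\<close>
  have bound: "?g k \<le> M + (\<Sum>n. ?g (n + m))" if "k < m" for m
  proof -
    define \<omega> where "\<omega> = cis (2 * pi / real m)"
    \<comment> \<open>\<open>d n\<close> is the total weight of \<open>c n\<close> in the sum
      \<open>F\<close> below: \<open>m * r ^ k\<close> for n = k, zero for every other n < m, and at
      most \<open>m * r ^ n\<close> in modulus always.\<close>
    define d where "d n = (\<Sum>j<m. (\<omega> ^ n / \<omega> ^ k) ^ j) * of_real r ^ n" for n
    have norm\<omega>: "cmod (\<omega> ^ j) = 1" for j by (simp add: \<omega>_def norm_power)
    have \<omega>0: "\<omega> \<noteq> 0" by (simp add: \<omega>_def)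
    define F where "F = (\<Sum>j<m. scaleC (1 / (\<omega> ^ k) ^ j) (f (of_real r * \<omega> ^ j)))"
    have "(\<lambda>n. \<Sum>j<m. scaleC (1 / (\<omega> ^ k) ^ j) (scaleC ((of_real r * \<omega> ^ j) ^ n) (c n))) sums F"
      unfolding F_def
      by (intro sums_sum bounded_linear.sums[OF bounded_linear_scaleC] f)
        (simp add: norm_mult norm\<omega> \<open>0 \<le> r\<close>)
    moreover have "(\<Sum>j<m. scaleC (1 / (\<omega> ^ k) ^ j) (scaleC ((of_real r * \<omega> ^ j) ^ n) (c n)))
        = scaleC (d n) (c n)" for n
      unfolding d_def sum_distrib_right scaleC_sum_left scaleC_scaleC
      by (intro sum.cong refl arg_cong2[where f = scaleC])
        (simp add: power_mult_distrib power_divide mult_ac flip: power_mult)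
    ultimately have sumsF: "(\<lambda>n. scaleC (d n) (c n)) sums F" by simp
    have "norm F \<le> (\<Sum>j<m. M)"
      unfolding F_def
      by (rule sum_norm_le)
        (use norm\<omega> in \<open>simp add: norm_scaleC norm_divide norm_power norm_mult M \<open>0 \<le> r\<close>\<close>)
    then have F: "norm F \<le> real m * M" by simp
    have "d n = 0" if "n < m" "n \<noteq> k" for n
      using sum_roots_unity_quotient[OF \<open>k < m\<close> that] by (simp add: d_def \<omega>_def)
    then have "(\<Sum>n<m. scaleC (d n) (c n)) = (\<Sum>n\<in>{k}. scaleC (d n) (c n))"
      using \<open>k < m\<close> by (intro sum.mono_neutral_right) auto
    also have "\<dots> = scaleC (of_nat m * of_real r ^ k) (c k)"
      by (simp add: d_def \<omega>0)
    finally have head: "(\<Sum>n<m. scaleC (d n) (c n)) = scaleC (of_nat m * of_real r ^ k) (c k)" .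
    have tail: "(\<lambda>n. scaleC (d (n + m)) (c (n + m))) sums
        (F - scaleC (of_nat m * of_real r ^ k) (c k))"
      using sums_split_initial_segment[OF sumsF, of m] by (simp only: head)
    have "cmod (d n) \<le> real m * r ^ n" for n
    proof -
      have "cmod (\<Sum>j<m. (\<omega> ^ n / \<omega> ^ k) ^ j) \<le> (\<Sum>j<m. 1)"
        by (rule sum_norm_le) (use norm\<omega> in \<open>simp add: norm_divide norm_power\<close>)
      then show ?thesis
        unfolding d_def using \<open>0 \<le> r\<close> by (simp add: norm_mult norm_power mult_right_mono)
    qed
    then have term_le: "norm (scaleC (d n) (c n)) \<le> real m * ?g n" for n
      using mult_right_mono[of "cmod (d n)" "real m * r ^ n" "norm (c n)"]
      by (simp add: norm_scaleC mult_ac)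
    have sg: "summable (\<lambda>n. ?g (n + m))" using summable_ignore_initial_segment[OF summable] .
    have "norm (F - scaleC (of_nat m * of_real r ^ k) (c k)) \<le> (\<Sum>n. real m * ?g (n + m))"
      unfolding sums_unique[OF tail]
      by (rule norm_suminf_le[OF term_le summable_mult[OF sg]])
    also have "\<dots> = real m * (\<Sum>n. ?g (n + m))" by (rule suminf_mult[OF sg])
    finally have "norm (scaleC (of_nat m * of_real r ^ k) (c k))
        \<le> real m * M + real m * (\<Sum>n. ?g (n + m))"
      using F norm_triangle_ineq2[of "scaleC (of_nat m * of_real r ^ k) (c k)" F]
      by (simp add: norm_minus_commute)
    then have "real m * ?g k \<le> real m * (M + (\<Sum>n. ?g (n + m)))"
      using \<open>0 \<le> r\<close> by (simp add: norm_scaleC norm_mult norm_power algebra_simps)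
    then show ?thesis using \<open>k < m\<close> by simp
  qed
  \<comment> \<open>The tails of a convergent series vanish as the number of sample points
    grows.\<close>
  have "(\<lambda>m. M + (\<Sum>n. ?g (n + m))) \<longlonglongrightarrow> M + 0"
    by (intro tendsto_intros suminf_exist_split2 summable)
  then show ?thesis
    using tendsto_lowerbound[OF _ eventually_mono[OF eventually_gt_at_top[of k] bound]] by auto
qed

section \<open>The entire function with coefficients from \<open>Cn1\<close>, and its growth\<close>

text \<open>The Cauchy product of the two exponential series: the signs come from
  \<open>- z\<close>, and the reciprocal factorials combine to a binomial coefficient over
  \<open>fact n\<close>.\<close>

lemma exp_mult_exp_sums_Cn1:
  fixes a b :: "'a::cstar_algebra"
  shows "(\<lambda>n. scaleC (z ^ n) (Cn1 a b n /\<^sub>R fact n)) sums (exp (scaleC z a) * exp (- scaleC z b))"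
proof -
  let ?x = "scaleC z a" and ?y = "- scaleC z b"
  have "(\<lambda>n. \<Sum>i\<le>n. (?x ^ i /\<^sub>R fact i) * (?y ^ (n - i) /\<^sub>R fact (n - i))) sums
      ((\<Sum>n. ?x ^ n /\<^sub>R fact n) * (\<Sum>n. ?y ^ n /\<^sub>R fact n))"
    by (intro Cauchy_product_sums summable_norm_exp)
  moreover have "(\<Sum>i\<le>n. (?x ^ i /\<^sub>R fact i) * (?y ^ (n - i) /\<^sub>R fact (n - i)))
      = scaleC (z ^ n) (Cn1 a b n /\<^sub>R fact n)" for n
  proof -
    have "(\<Sum>i\<le>n. (?x ^ i /\<^sub>R fact i) * (?y ^ (n - i) /\<^sub>R fact (n - i)))
        = (\<Sum>k\<le>n. (?x ^ (n - k) /\<^sub>R fact (n - k)) * (?y ^ k /\<^sub>R fact k))"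
      by (rule sum.reindex_bij_witness[where i = "\<lambda>k. n - k" and j = "\<lambda>k. n - k"]) auto
    also have "\<dots> = (\<Sum>k\<le>n. scaleC (z ^ n)
        ((((-1) ^ k * of_nat (n choose k)) * (a ^ (n - k) * b ^ k)) /\<^sub>R fact n))"
    proof (rule sum.cong)
      fix k assume "k \<in> {..n}"
      then have k: "k \<le> n" by simp
      have "z ^ (n - k) * (- z) ^ k = (-1) ^ k * z ^ n"
        using k by (subst power_minus) (simp add: power_add[symmetric])
      then have "(?x ^ (n - k) /\<^sub>R fact (n - k)) * (?y ^ k /\<^sub>R fact k)
          = scaleC (of_real ((-1) ^ k / (fact (n - k) * fact k)) * z ^ n) (a ^ (n - k) * b ^ k)"
        by (simp add: scaleC_minus_left[symmetric] scaleC_power scaleC_scaleR[symmetric]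
            scaleC_scaleC scaleC_mult_left scaleC_mult_right field_simps)
      also have "(-1) ^ k / (fact (n - k) * fact k) = ((-1) ^ k * real (n choose k)) / fact n"
        using k by (simp add: binomial_fact)
      also have "scaleC (of_real \<dots> * z ^ n) (a ^ (n - k) * b ^ k)
          = scaleC (z ^ n) ((((-1) ^ k * real (n choose k)) *\<^sub>R (a ^ (n - k) * b ^ k)) /\<^sub>R fact n)"
        by (simp add: scaleC_scaleR[symmetric] scaleC_scaleC field_simps)
      also have "((-1) ^ k * real (n choose k)) *\<^sub>R (a ^ (n - k) * b ^ k)
          = ((-1) ^ k * of_nat (n choose k)) * (a ^ (n - k) * b ^ k)"
        by (simp add: scaleR_conv_of_real)
      finally show "(?x ^ (n - k) /\<^sub>R fact (n - k)) * (?y ^ k /\<^sub>R fact k) = scaleC (z ^ n)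
        ((((-1) ^ k * of_nat (n choose k)) * (a ^ (n - k) * b ^ k)) /\<^sub>R fact n)" .
    qed simp
    also have "\<dots> = scaleC (z ^ n) (Cn1 a b n /\<^sub>R fact n)"
      unfolding Cn1_def scaleR_sum_right
      by (rule linear_sum[symmetric], rule bounded_linear.linear, rule bounded_linear_scaleC)
    finally show ?thesis .
  qed
  ultimately show ?thesis by (simp add: exp_def)
qed

lemma rho_le_0_bound:
  fixes a b :: "'a::real_normed_algebra_1"
  assumes "rho a b \<le> 0" and "0 < e"
  obtains K where "\<And>n. norm (Cn1 a b n) \<le> K * e ^ n"
proof -
  have "rho a b < ereal e" using assms by (simp add: le_less_trans)
  then have "eventually (\<lambda>n. ereal (root n (norm (Cn1 a b n))) < ereal e) sequentially"
    unfolding rho_def by (rule Limsup_lessD)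
  then have "eventually (\<lambda>n. norm (Cn1 a b n) \<le> e ^ n) sequentially"
    \<comment> \<open>\<open>root 0\<close> is constantly 0, so the n-th power undoes the root only
      for n > 0.\<close>
    using eventually_gt_at_top[of 0]
  proof eventually_elim
    case (elim n)
    then have "root n (norm (Cn1 a b n)) ^ n \<le> e ^ n" by (intro power_mono) auto
    then show ?case using elim by simp
  qed
  then obtain N where N: "\<And>n. n \<ge> N \<Longrightarrow> norm (Cn1 a b n) \<le> e ^ n"
    by (auto simp: eventually_sequentially)
  \<comment> \<open>The summand 1 serves all n from \<open>N\<close> on; the sum absorbs the
    finitely many earlier terms.\<close>
  define K where "K = 1 + (\<Sum>n<N. norm (Cn1 a b n) / e ^ n)"
  have nonneg: "0 \<le> (\<Sum>n<N. norm (Cn1 a b n) / e ^ n)"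
    using assms by (intro sum_nonneg) auto
  show thesis
  proof (rule that)
    fix n
    show "norm (Cn1 a b n) \<le> K * e ^ n"
    proof (cases "n < N")
      case True
      then have "norm (Cn1 a b n) / e ^ n \<le> (\<Sum>n<N. norm (Cn1 a b n) / e ^ n)"
        using assms by (intro member_le_sum) auto
      then have "norm (Cn1 a b n) / e ^ n \<le> K" by (simp add: K_def)
      then show ?thesis using assms by (simp add: divide_le_eq)
    next
      case False
      then have "norm (Cn1 a b n) \<le> 1 * e ^ n" using N by simp
      also have "\<dots> \<le> K * e ^ n" using assms nonneg by (intro mult_right_mono) (auto simp: K_def)
      finally show ?thesis .
    qed
  qed
qed

lemma norm_exp_mult_exp_le_exp:
  fixes a b :: "'a::cstar_algebra"
  assumes K: "\<And>n. norm (Cn1 a b n) \<le> K * e ^ n"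
  shows "norm (exp (scaleC z a) * exp (- scaleC z b)) \<le> K * exp (e * cmod z)"
proof -
  have "(\<lambda>n. (e * cmod z) ^ n /\<^sub>R fact n) sums exp (e * cmod z)" by (rule exp_converges)
  then have *: "(\<lambda>n. K * ((e * cmod z) ^ n /\<^sub>R fact n)) sums (K * exp (e * cmod z))"
    by (rule sums_mult)
  have "norm (scaleC (z ^ n) (Cn1 a b n /\<^sub>R fact n)) \<le> K * ((e * cmod z) ^ n /\<^sub>R fact n)" for n
    using mult_left_mono[OF K[of n], of "cmod z ^ n / fact n"]
    by (simp add: norm_scaleC norm_power power_mult_distrib field_simps)
  from norm_suminf_le[OF this sums_summable[OF *]] show ?thesis
    by (simp only: sums_unique[OF exp_mult_exp_sums_Cn1, symmetric] sums_unique[OF *, symmetric])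
qed

lemma norm_exp_mult_exp_le_1:
  fixes a b :: "'a::cstar_algebra"
  assumes "normal a" "normal b" "rho a b \<le> 0"
  shows "norm (exp (scaleC z a) * exp (- scaleC z b)) \<le> 1"
proof -
  define N where "N z = norm (exp (scaleC z a) * exp (- scaleC z b))" for z
  have double: "N z ^ 2 \<le> N (2 * z)" for z
    using norm_exp_mult_exp_normal_square_le[of "scaleC z a" "- scaleC z b"] assms
    unfolding N_def mult_2 scaleC_add_left by (simp add: normal_scaleC normal_minus)
  have iter: "N z ^ (2 ^ m) \<le> N (2 ^ m * z)" for m
  proof (induction m)
    case (Suc m)
    have "N z ^ (2 ^ Suc m) = (N z ^ (2 ^ m))\<^sup>2" by (simp add: power_mult[symmetric] mult.commute)
    also have "\<dots> \<le> (N (2 ^ m * z))\<^sup>2" using Suc by (intro power_mono) (auto simp: N_def)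
    also have "\<dots> \<le> N (2 ^ Suc m * z)" using double[of "2 ^ m * z"] by (simp add: mult.assoc)
    finally show ?case .
  qed simp
  have le: "N z \<le> exp (e * cmod z)" if e: "0 < e" for e
  proof -
    obtain K where K: "\<And>n. norm (Cn1 a b n) \<le> K * e ^ n"
      using rho_le_0_bound[OF assms(3) e] by blast
    show ?thesis
    proof (rule le_of_power_le_mult_power)
      fix m :: nat
      let ?q = "exp (e * cmod z)"
      have "N z ^ (2 ^ m) \<le> K * exp (e * cmod (2 ^ m * z))"
        using iter[of m] norm_exp_mult_exp_le_exp[OF K, of "2 ^ m * z"] by (simp add: N_def)
      \<comment> \<open>The growth bound is a pure power of \<open>?q\<close>, whereas
        \<open>K\<close> does not depend on m and so disappears on taking roots. One factor
        \<open>?q\<close> then joins the constant to match the exponent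
        \<open>2 ^ m - 1\<close>.\<close>
      also have "exp (e * cmod (2 ^ m * z)) = ?q ^ (2 ^ m)"
        by (simp add: norm_mult norm_power exp_of_nat_mult[symmetric] mult_ac)
      also have "\<dots> = ?q * ?q ^ (2 ^ m - 1)"
        using power_minus_mult[of "2 ^ m" ?q] by (simp add: mult.commute)
      finally show "N z ^ (2 ^ m) \<le> (K * ?q) * ?q ^ (2 ^ m - 1)" by (simp add: mult.assoc)
    qed simp
  qed
  have "((\<lambda>e. exp (e * cmod z)) \<longlongrightarrow> exp (0 * cmod z)) (at_right 0)"
    by (intro tendsto_intros)
  moreover have "eventually (\<lambda>e. N z \<le> exp (e * cmod z)) (at_right 0)"
    using le by (auto simp: eventually_at_filter)
  ultimately have "N z \<le> exp (0 * cmod z)" by (intro tendsto_lowerbound) auto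
  then show ?thesis by (simp add: N_def)
qed

section \<open>Liouville argument and the converse\<close>

text \<open>The Cauchy estimate bounds the linear coefficient \<open>Cn1 a b 1\<close>, which is
  \<open>a - b\<close>, by \<open>1 / r\<close> for every radius r > 0.\<close>

lemma normal_eq_of_rho_le_0:
  fixes a b :: "'a::cstar_algebra"
  assumes "normal a" "normal b" "rho a b \<le> 0"
  shows "a = b"
proof -
  \<comment> \<open>Exponential growth with base 1 already makes the series converge absolutely at
    every radius.\<close>
  obtain K where K: "\<And>n. norm (Cn1 a b n) \<le> K * 1 ^ n"
    using rho_le_0_bound[OF assms(3), of 1] by auto
  have est: "norm (Cn1 a b 1) * r \<le> 1" if "0 \<le> r" for r
  proof -
    have "norm (Cn1 a b 1 /\<^sub>R fact 1) * r ^ 1 \<le> 1"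
    proof (rule power_series_Cauchy_estimate[OF _ that exp_mult_exp_sums_Cn1
          norm_exp_mult_exp_le_1[OF assms]])
      show "summable (\<lambda>n. norm (Cn1 a b n /\<^sub>R fact n) * r ^ n)"
      proof (rule summable_comparison_test')
        show "summable (\<lambda>n. K * (r ^ n /\<^sub>R fact n))"
          by (intro summable_mult summable_exp_generic)
        show "norm (norm (Cn1 a b n /\<^sub>R fact n) * r ^ n) \<le> K * (r ^ n /\<^sub>R fact n)" for n
          using mult_right_mono[OF K[of n], of "r ^ n / fact n"] that
          by (simp add: field_simps)
      qed
    qed
    then show ?thesis by simp
  qed
  have "norm (Cn1 a b 1) = 0"
  proof (rule ccontr)
    assume "norm (Cn1 a b 1) \<noteq> 0"
    \<comment> \<open>At this radius the estimate would read \<open>2 \<le> 1\<close>.\<close>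
    then show False using est[of "2 / norm (Cn1 a b 1)"] by simp
  qed
  then show ?thesis by (simp add: Cn1_def)
qed

lemma Cn1_same:
  assumes "0 < n"
  shows "Cn1 a a n = 0"
proof -
  have "Cn1 a a n = (\<Sum>k\<le>n. (-1) ^ k * of_nat (n choose k)) * a ^ n"
    unfolding Cn1_def sum_distrib_right
    by (intro sum.cong) (auto simp: power_add[symmetric])
  \<comment> \<open>The alternating sum is evaluated in the commutative ring of integers and carried
    into the algebra by \<open>of_int\<close>.\<close>
  also have "(\<Sum>k\<le>n. (-1) ^ k * of_nat (n choose k))
      = (of_int (\<Sum>k\<le>n. (-1) ^ k * of_nat (n choose k)) :: 'a)"
    by simp
  also have "\<dots> = 0" using choose_alternating_sum[OF assms, where 'a = int] by (simp only: of_int_0)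
  finally show ?thesis by simp
qed

lemma rho_same: "rho a a = 0"
proof -
  have "root n (norm (Cn1 a a n)) = 0" for n
    \<comment> \<open>\<open>Cn1 a a 0\<close> is 1, but \<open>root 0\<close> sends it to
      0.\<close>
    by (cases "n = 0") (auto simp: Cn1_same)
  then show ?thesis by (simp add: rho_def Limsup_const flip: zero_ereal_def)
qed

theorem theorem3p4:
  fixes a b :: "'a::cstar_algebra"
  assumes "normal a" and "normal b"
  shows "(a = b \<longleftrightarrow> rho a b = 0) \<and> (a = b \<longleftrightarrow> d_rho a b = 0)"
proof -
  have "a = b" if "rho a b \<le> 0" using normal_eq_of_rho_le_0[OF assms that] .
  \<comment> \<open>Hence \<open>d_rho a b = 0\<close> gives only \<open>rho a b \<le> 0\<close>
    directly, which is the form the preceding implication takes.\<close>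
  moreover have "rho a b \<le> d_rho a b" by (simp add: d_rho_def)
  moreover have "rho a b = 0 \<and> d_rho a b = 0" if "a = b"
    using that by (simp add: d_rho_def rho_same)
  ultimately show ?thesis by auto
qed

end
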